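(* Let $K$ be a field, $\sigma$ an automorphism of $K$ with fixed field $F=\mathrm{Fix}(\sigma)$, $R=K[t;\sigma]$, and let $f\in R$ be a monic polynomial of degree $m\ge 2$ which is not right invariant. Write $N=\mathrm{Nuc}(S_f)$. Suppose that $f(t)\in F[t]\subset R$ is bounded and that $$\mathrm{Nuc}_r(S_f)=N[t;\sigma]/N[t;\sigma]f.$$ Then $f$ is irreducible in $R$ if and only if $f$ is irreducible in $N[t;\sigma]$.
   Context: $R=K[t;\sigma]$ is the twisted polynomial ring: polynomials $\sum b_it^i$ with $b_i\in K$, termwise addition, and multiplication determined by $ta=\sigma(a)t$ for $a\in K$. $f$ is right invariant if $Rf$ is a two-sided ideal of $R$; $f$ is bounded if there is a nonzero $f^*\in R$ such that $Rf^*$ is the largest two-sided ideal of $R$ contained in $Rf$. A polynomial is irreducible if it is not a unit and not a product of two polynomials of smaller degree. The Petit algebra $S_f=K[t;\sigma]/K[t;\sigma]f$ is the unital nonassociative $F$-algebra with underlying additive group $\{g\in R:\deg g<m\}$ and multiplication $g\circ h=gh\,\mathrm{mod}_r f$, the remainder of $gh$ under right division by $f$. Left, middle and right nucleus are $\mathrm{Nuc}_l(S_f)=\{x:(xy)z=x(yz)\ \forall y,z\}$, $\mathrm{Nuc}_m(S_f)=\{x:(yx)z=y(xz)\ \forall y,z\}$, $\mathrm{Nuc}_r(S_f)=\{x:(yz)x=y(zx)\ \forall y,z\}$, and $\mathrm{Nuc}(S_f)$ is their intersection, a subfield of $K$ stable under $\sigma$ when $f$ is not right invariant. In $N[t;\sigma]$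 the symbol $\sigma$ stands for $\sigma|_N$, and $N[t;\sigma]/N[t;\sigma]f$ is the Petit algebra formed in the same way from $N[t;\sigma|_N]$ and $f$ (polynomials of degree $<m$ with coefficients in $N$, multiplied modulo right division by $f$), viewed as a subset of $S_f$. *)

theory Defs
  imports "HOL-Computational_Algebra.Polynomial" "HOL-Algebra.Ideal"
begin

definition field_automorphism :: "('a::field \<Rightarrow> 'a) \<Rightarrow> bool" where
  "field_automorphism \<sigma> \<longleftrightarrow> bij \<sigma> \<and>
     (\<forall>x y. \<sigma> (x + y) = \<sigma> x + \<sigma> y) \<and> (\<forall>x y. \<sigma> (x * y) = \<sigma> x * \<sigma> y) \<and> \<sigma> 1 = 1"

definition fixed_field :: "('a::field \<Rightarrow> 'a) \<Rightarrow> 'a set" where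
  "fixed_field \<sigma> = {a. \<sigma> a = a}"

definition polys_over :: "'a::zero set \<Rightarrow> 'a poly set" where
  "polys_over A = {p. \<forall>i. coeff p i \<in> A}"

(* The biadditive product determined by t a = \<sigma>(a) t, i.e. (b t^i)(c t^j) = b \<sigma>^i(c) t^(i+j).
   Coefficients are written on the left of the powers of t. The type 'a poly only provides the
   additive structure; its commutative product is not used. *)
definition skew_mult :: "('a::field \<Rightarrow> 'a) \<Rightarrow> 'a poly \<Rightarrow> 'a poly \<Rightarrow> 'a poly" where
  "skew_mult \<sigma> g h =
     (\<Sum>i\<le>degree g. \<Sum>j\<le>degree h. monom (coeff g i * (\<sigma> ^^ i) (coeff h j)) (i + j))"

(* A[t; \<sigma>] for a \<sigma>-stable subfield A; A = UNIV gives K[t; \<sigma>]. *)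
definition skew_poly_ring :: "('a::field \<Rightarrow> 'a) \<Rightarrow> 'a set \<Rightarrow> 'a poly ring" where
  "skew_poly_ring \<sigma> A =
     \<lparr>carrier = polys_over A, monoid.mult = skew_mult \<sigma>, one = 1, zero = 0, add = (+)\<rparr>"

definition left_multiples :: "('b, 'c) ring_scheme \<Rightarrow> 'b \<Rightarrow> 'b set" where
  "left_multiples R f = {g \<otimes>\<^bsub>R\<^esub> f | g. g \<in> carrier R}"

(* The locale ideal of HOL-Algebra is about two-sided ideals of possibly noncommutative rings. *)
definition right_invariant :: "('b, 'c) ring_scheme \<Rightarrow> 'b \<Rightarrow> bool" where
  "right_invariant R f \<longleftrightarrow> ideal (left_multiples R f) R"

definition bounded_elem :: "('b, 'c) ring_scheme \<Rightarrow> 'b \<Rightarrow> bool" where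
  "bounded_elem R f \<longleftrightarrow>
     (\<exists>f' \<in> carrier R - {\<zero>\<^bsub>R\<^esub>}.
        ideal (left_multiples R f') R \<and> left_multiples R f' \<subseteq> left_multiples R f \<and>
        (\<forall>I. ideal I R \<longrightarrow> I \<subseteq> left_multiples R f \<longrightarrow> I \<subseteq> left_multiples R f'))"

definition skew_irreducible :: "('a::field poly, 'c) ring_scheme \<Rightarrow> 'a poly \<Rightarrow> bool" where
  "skew_irreducible R p \<longleftrightarrow> p \<in> carrier R \<and> p \<notin> Units R \<and>
     \<not> (\<exists>g \<in> carrier R. \<exists>h \<in> carrier R.
          degree g < degree p \<and> degree h < degree p \<and> p = g \<otimes>\<^bsub>R\<^esub> h)"

(* Right division by f puts the quotient on the left of f: g = q f + r. *)
definition right_rem :: "('a::field poly, 'c) ring_scheme \<Rightarrow> 'a poly \<Rightarrow> 'a poly \<Rightarrow> 'a poly" where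
  "right_rem R f g = (THE r. r \<in> carrier R \<and> (r = 0 \<or> degree r < degree f) \<and>
     (\<exists>q \<in> carrier R. g = q \<otimes>\<^bsub>R\<^esub> f \<oplus>\<^bsub>R\<^esub> r))"

(* A[t; \<sigma>]/A[t; \<sigma>]f. The record type ring only serves as a container for the operations:
   the product is in general not associative. *)
definition petit_algebra :: "('a::field \<Rightarrow> 'a) \<Rightarrow> 'a set \<Rightarrow> 'a poly \<Rightarrow> 'a poly ring" where
  "petit_algebra \<sigma> A f =
     \<lparr>carrier = {g \<in> polys_over A. g = 0 \<or> degree g < degree f},
      monoid.mult = (\<lambda>g h. right_rem (skew_poly_ring \<sigma> A) f (skew_mult \<sigma> g h)),
      one = 1, zero = 0, add = (+)\<rparr>"

definition Nuc_l :: "('b, 'c) ring_scheme \<Rightarrow> 'b set" where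
  "Nuc_l S = {x \<in> carrier S. \<forall>y \<in> carrier S. \<forall>z \<in> carrier S.
     (x \<otimes>\<^bsub>S\<^esub> y) \<otimes>\<^bsub>S\<^esub> z = x \<otimes>\<^bsub>S\<^esub> (y \<otimes>\<^bsub>S\<^esub> z)}"

definition Nuc_m :: "('b, 'c) ring_scheme \<Rightarrow> 'b set" where
  "Nuc_m S = {x \<in> carrier S. \<forall>y \<in> carrier S. \<forall>z \<in> carrier S.
     (y \<otimes>\<^bsub>S\<^esub> x) \<otimes>\<^bsub>S\<^esub> z = y \<otimes>\<^bsub>S\<^esub> (x \<otimes>\<^bsub>S\<^esub> z)}"

definition Nuc_r :: "('b, 'c) ring_scheme \<Rightarrow> 'b set" where
  "Nuc_r S = {x \<in> carrier S. \<forall>y \<in> carrier S. \<forall>z \<in> carrier S.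
     (y \<otimes>\<^bsub>S\<^esub> z) \<otimes>\<^bsub>S\<^esub> x = y \<otimes>\<^bsub>S\<^esub> (z \<otimes>\<^bsub>S\<^esub> x)}"

definition Nuc :: "('b, 'c) ring_scheme \<Rightarrow> 'b set" where
  "Nuc S = Nuc_l S \<inter> Nuc_m S \<inter> Nuc_r S"

(* The nucleus is a set of polynomials; when f is not right invariant all of them are constant.
   This is the corresponding subset of K under the identification of a with [:a:]. *)
definition nucleus_field :: "('a::field \<Rightarrow> 'a) \<Rightarrow> 'a poly \<Rightarrow> 'a set" where
  "nucleus_field \<sigma> f = {a. [:a:] \<in> Nuc (petit_algebra \<sigma> UNIV f)}"


lemma skew_mult_t_const: "skew_mult \<sigma> (monom 1 1) [:a:] = skew_mult \<sigma> [:\<sigma> a:] (monom 1 1)"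
  if "field_automorphism \<sigma>"
proof -
  have "\<sigma> 0 + \<sigma> 0 = \<sigma> 0 + 0"
    using that unfolding field_automorphism_def by (metis add_0_right)
  then have "\<sigma> 0 = 0" by (simp only: add_left_cancel)
  then show ?thesis using that
    by (simp add: skew_mult_def field_automorphism_def degree_monom_eq monom_0 sum.atMost_Suc)
qed

lemma coeff_skew_mult:
  assumes "field_automorphism \<sigma>"
  shows "coeff (skew_mult \<sigma> g h) n = (\<Sum>i\<le>n. coeff g i * (\<sigma> ^^ i) (coeff h (n - i)))"
proof -
  have "\<sigma> 0 + \<sigma> 0 = \<sigma> 0 + 0"
    using assms unfolding field_automorphism_def by (metis add_0_right)
  then have s0: "\<sigma> 0 = 0" by (simp only: add_left_cancel)
  have p0: "(\<sigma> ^^ i) 0 = 0" for i by (induction i) (auto simp: s0)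
  have inner: "(\<Sum>j\<le>degree h. if i + j = n then coeff g i * (\<sigma> ^^ i) (coeff h j) else 0)
      = (if i \<le> n then coeff g i * (\<sigma> ^^ i) (coeff h (n - i)) else 0)" for i
  proof (cases "i \<le> n")
    case True
    have "(\<Sum>j\<le>degree h. if i + j = n then coeff g i * (\<sigma> ^^ i) (coeff h j) else 0)
       = (\<Sum>j\<le>degree h. if j = n - i then coeff g i * (\<sigma> ^^ i) (coeff h j) else 0)"
      using True by (intro sum.cong) auto
    also have "\<dots> = (if n - i \<le> degree h then coeff g i * (\<sigma> ^^ i) (coeff h (n - i)) else 0)"
      by (simp add: sum.delta)
    finally show ?thesis using True by (auto simp: coeff_eq_0 p0)
  qed (auto intro!: sum.neutral)
  have "coeff (skew_mult \<sigma> g h) n =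
     (\<Sum>i\<le>degree g. if i \<le> n then coeff g i * (\<sigma> ^^ i) (coeff h (n - i)) else 0)"
    by (simp add: skew_mult_def coeff_sum inner)
  also have "\<dots> = (\<Sum>i\<le>n. coeff g i * (\<sigma> ^^ i) (coeff h (n - i)))"
    by (intro sum.mono_neutral_cong) (auto simp: coeff_eq_0)
  finally show ?thesis .
qed

lemma ring_skew_poly_ring:
  assumes aut: "field_automorphism \<sigma>"
  shows "ring (skew_poly_ring \<sigma> UNIV)"
proof -
  note [simp] = coeff_skew_mult[OF aut]
  have add: "(\<sigma> ^^ i) (x + y) = (\<sigma> ^^ i) x + (\<sigma> ^^ i) y" for i x y
    using aut by (induction i) (auto simp: field_automorphism_def)
  have mul: "(\<sigma> ^^ i) (x * y) = (\<sigma> ^^ i) x * (\<sigma> ^^ i) y" for i x y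
    using aut by (induction i) (auto simp: field_automorphism_def)
  have one: "(\<sigma> ^^ i) 1 = 1" for i
    using aut by (induction i) (auto simp: field_automorphism_def)
  have zero: "(\<sigma> ^^ i) 0 = 0" for i
    using add[of i 0 0] by (metis add_0_right add_left_cancel)
  have sum: "(\<sigma> ^^ i) (sum u A) = (\<Sum>x\<in>A. (\<sigma> ^^ i) (u x))" for i u and A :: "nat set"
    by (induction A rule: infinite_finite_induct) (auto simp: zero add)
  have assoc: "skew_mult \<sigma> (skew_mult \<sigma> g h) l = skew_mult \<sigma> g (skew_mult \<sigma> h l)" for g h l
  proof (rule poly_eqI)
    fix n
    let ?u = "\<lambda>a b c. coeff g a * (\<sigma> ^^ a) (coeff h b) * (\<sigma> ^^ (a + b)) (coeff l c)"
    have "coeff (skew_mult \<sigma> (skew_mult \<sigma> g h) l) n = (\<Sum>i\<le>n. \<Sum>a\<le>i. ?u a (i - a) (n - i))"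
      by (simp add: sum_distrib_right)
    also have "\<dots> = (\<Sum>a\<le>n. \<Sum>b\<le>n - a. ?u a b (n - a - b))"
      by (subst (1 2) sum.Sigma, simp, simp, simp, simp)
        (rule sum.reindex_bij_witness
          [where j = "\<lambda>(i, a). (a, i - a)" and i = "\<lambda>(a, b). (a + b, a)"], auto)
    also have "\<dots> = coeff (skew_mult \<sigma> g (skew_mult \<sigma> h l)) n"
      by (simp add: sum mul sum_distrib_left mult.assoc funpow_add)
    finally show "coeff (skew_mult \<sigma> (skew_mult \<sigma> g h) l) n =
      coeff (skew_mult \<sigma> g (skew_mult \<sigma> h l)) n" .
  qed
  have one_l: "skew_mult \<sigma> 1 g = g" for g
    by (rule poly_eqI) (simp add: if_distrib if_distribR sum.delta cong: if_cong)
  have one_r: "skew_mult \<sigma> g 1 = g" for g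
  proof (rule poly_eqI)
    fix n
    have "coeff (skew_mult \<sigma> g 1) n = (\<Sum>i\<le>n. if i = n then coeff g i else 0)"
      unfolding coeff_skew_mult[OF aut] by (intro sum.cong) (auto simp: one zero)
    also have "\<dots> = coeff g n" by simp
    finally show "coeff (skew_mult \<sigma> g 1) n = coeff g n" .
  qed
  have dl: "skew_mult \<sigma> (g + h) l = skew_mult \<sigma> g l + skew_mult \<sigma> h l" for g h l
    by (rule poly_eqI) (simp add: algebra_simps sum.distrib)
  have dr: "skew_mult \<sigma> l (g + h) = skew_mult \<sigma> l g + skew_mult \<sigma> l h" for g h l
    by (rule poly_eqI) (simp add: add algebra_simps sum.distrib)
  have inv: "\<exists>y. y + x = 0" for x :: "'a poly"
    by (rule exI[of _ "- x"]) simp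
  show ?thesis
    by unfold_locales
      (auto simp: skew_poly_ring_def polys_over_def assoc one_l one_r dl dr Units_def
        add.assoc add.commute inv intro: exI[of _ "- x" for x])
qed

end

theory Submission
  imports Defs
begin

text \<open>
  Write \<open>R = K[t;\<sigma>]\<close> and let \<open>M\<close> be the left module \<open>R/Rf\<close>. A remainder \<open>y\<close> with
  \<open>f y \<in> R f\<close> is the same as an endomorphism of \<open>M\<close>, namely right multiplication by \<open>y\<close>, and
  every such \<open>y\<close> lies in the right nucleus of \<open>S\<^sub>f\<close> (\<open>Nuc_r_petit_if\<close>). The hypothesis on the
  right nucleus therefore says that all endomorphisms of \<open>M\<close> come from polynomials over \<open>N\<close>.

  A factorization over \<open>N\<close> is a factorization over \<open>K\<close>, so the content is the converse: if \<open>f\<close> is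
  irreducible over \<open>N\<close> then it is irreducible over \<open>K\<close>. Two facts contradict each other when
  \<open>f\<close> is reducible over \<open>K\<close>.

  First, \<open>N\<close> consists of the \<open>a \<in> K\<close> with \<open>f a = \<sigma>\<^sup>m(a) f\<close>, so \<open>N\<close> is a \<open>\<sigma>\<close>-stable field, and
  because the coefficients of \<open>f\<close> are fixed by \<open>\<sigma>\<close>, one gets \<open>f u \<in> R f\<close> for every
  \<open>u \<in> N[t;\<sigma>]\<close> (\<open>star_nucleus_polys\<close>). Hence \<open>N[t;\<sigma>]/N[t;\<sigma>]f\<close> is an associative ring, and if
  \<open>f\<close> is irreducible over \<open>N\<close> then it is a division ring, since \<open>N[t;\<sigma>]\<close> is a left principal
  ideal domain (\<open>irreducible_left_inverse\<close>, \<open>right_inverse_of_left_inverses\<close>). So every nonzero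
  endomorphism of \<open>M\<close> is invertible.

  Second, let \<open>f = g h\<close> be a proper factorization with \<open>h\<close> irreducible. Then \<open>M\<close> has the simple
  quotient \<open>R/Rh\<close>. Boundedness of \<open>f\<close> implies that this quotient also maps nontrivially to \<open>M\<close>
  (\<open>exists_hom_from_simple_quotient\<close>). The composite \<open>M \<rightarrow> R/Rh \<rightarrow> M\<close> is a nonzero endomorphism
  that kills the class of \<open>h\<close>, which is not zero as \<open>deg h < deg f\<close>; it is not invertible.
\<close>

section \<open>Arithmetic of skew polynomials\<close>

locale skew_polynomials =
  fixes \<sigma> :: "'a::field \<Rightarrow> 'a"
  assumes aut: "field_automorphism \<sigma>"
begin

abbreviation star :: "'a poly \<Rightarrow> 'a poly \<Rightarrow> 'a poly" (infixl "\<star>" 70) where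
  "g \<star> h \<equiv> skew_mult \<sigma> g h"

lemma sigma_pow_add: "(\<sigma> ^^ i) (x + y) = (\<sigma> ^^ i) x + (\<sigma> ^^ i) y"
  using aut by (induction i) (auto simp: field_automorphism_def)

lemma sigma_pow_mult: "(\<sigma> ^^ i) (x * y) = (\<sigma> ^^ i) x * (\<sigma> ^^ i) y"
  using aut by (induction i) (auto simp: field_automorphism_def)

lemma sigma_pow_1 [simp]: "(\<sigma> ^^ i) 1 = 1"
  using aut by (induction i) (auto simp: field_automorphism_def)

lemma bij_sigma_pow: "bij (\<sigma> ^^ i)"
  using aut by (simp add: field_automorphism_def bij_betw_funpow)

lemma sigma_pow_0 [simp]: "(\<sigma> ^^ i) 0 = 0"
  using sigma_pow_add[of i 0 0] by (metis add_0_right add_left_cancel)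

lemma sigma_pow_eq_iff [simp]: "(\<sigma> ^^ i) x = (\<sigma> ^^ i) y \<longleftrightarrow> x = y"
  using bij_sigma_pow[of i] by (auto simp: bij_def inj_eq)

lemma sigma_pow_eq_0_iff [simp]: "(\<sigma> ^^ i) x = 0 \<longleftrightarrow> x = 0"
  using sigma_pow_eq_iff[of i x 0] by (simp del: sigma_pow_eq_iff)

lemma sigma_pow_diff: "(\<sigma> ^^ i) (x - y) = (\<sigma> ^^ i) x - (\<sigma> ^^ i) y"
  using sigma_pow_add[of i "x - y" y] by simp

lemma sigma_pow_inverse: "(\<sigma> ^^ i) (inverse x) = inverse ((\<sigma> ^^ i) x)"
proof (cases "x = 0")
  case False
  then have "(\<sigma> ^^ i) x * (\<sigma> ^^ i) (inverse x) = 1"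
    by (simp flip: sigma_pow_mult)
  then show ?thesis by (metis inverse_unique)
qed auto

lemmas coeff_star = coeff_skew_mult[OF aut]

lemma star_assoc: "a \<star> b \<star> c = a \<star> (b \<star> c)"
  using monoid.m_assoc[OF ring.is_monoid[OF ring_skew_poly_ring[OF aut]], of a b c]
  by (simp add: skew_poly_ring_def polys_over_def)

lemma star_1 [simp]: "1 \<star> a = a" "a \<star> 1 = a"
  using monoid.l_one[OF ring.is_monoid[OF ring_skew_poly_ring[OF aut]], of a]
    monoid.r_one[OF ring.is_monoid[OF ring_skew_poly_ring[OF aut]], of a]
  by (simp_all add: skew_poly_ring_def polys_over_def)

lemma star_add_left: "(a + b) \<star> c = a \<star> c + b \<star> c"
  using ring.ring_simprules(13)[OF ring_skew_poly_ring[OF aut], of a b c]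
  by (simp add: skew_poly_ring_def polys_over_def)

lemma star_add_right: "c \<star> (a + b) = c \<star> a + c \<star> b"
  by (rule poly_eqI) (simp add: coeff_star sigma_pow_add algebra_simps sum.distrib)

lemma star_0 [simp]: "0 \<star> a = 0" "a \<star> 0 = 0"
  by (rule poly_eqI, simp add: coeff_star)+

lemma star_diff_left: "(a - b) \<star> c = a \<star> c - b \<star> c"
  using star_add_left[of "a - b" b c] by simp

lemma star_diff_right: "c \<star> (a - b) = c \<star> a - c \<star> b"
  using star_add_right[of c "a - b" b] by simp

lemma star_minus: "(- a) \<star> c = - (a \<star> c)"
  using star_diff_left[of 0 a c] by simp

lemma coeff_monom_star:
  "coeff (monom c j \<star> d) i = (if j \<le> i then c * (\<sigma> ^^ j) (coeff d (i - j)) else 0)"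
  by (simp add: coeff_star if_distrib if_distribR cong: if_cong)

lemma coeff_star_monom:
  "coeff (d \<star> monom c j) i = (if j \<le> i then coeff d (i - j) * (\<sigma> ^^ (i - j)) c else 0)"
proof -
  have "coeff (d \<star> monom c j) i =
      (\<Sum>l\<le>i. if l = i - j then (if j \<le> i then coeff d l * (\<sigma> ^^ l) c else 0) else 0)"
    unfolding coeff_star by (intro sum.cong) auto
  then show ?thesis by simp
qed

lemma coeff_const_star: "coeff ([:c:] \<star> d) i = c * coeff d i"
  using coeff_monom_star[of c 0 d i] by (simp add: monom_0)

lemma coeff_star_const: "coeff (d \<star> [:c:]) i = coeff d i * (\<sigma> ^^ i) c"
  using coeff_star_monom[of d c 0 i] by (simp add: monom_0)

lemma coeff_star_beyond:
  assumes "degree g + degree h < n"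
  shows "coeff (g \<star> h) n = 0"
  unfolding coeff_star
proof (rule sum.neutral, safe)
  fix i show "coeff g i * (\<sigma> ^^ i) (coeff h (n - i)) = 0"
  proof (cases "i \<le> degree g")
    case True
    then have "degree h < n - i" using assms by linarith
    then show ?thesis by (simp add: coeff_eq_0)
  qed (simp add: coeff_eq_0)
qed

lemma coeff_star_top:
  "coeff (g \<star> h) (degree g + degree h) = lead_coeff g * (\<sigma> ^^ degree g) (lead_coeff h)"
proof -
  have "coeff (g \<star> h) (degree g + degree h) =
      (\<Sum>i\<le>degree g + degree h.
         if i = degree g then lead_coeff g * (\<sigma> ^^ degree g) (lead_coeff h) else 0)"
    unfolding coeff_star
  proof (rule sum.cong)
    fix i
    show "coeff g i * (\<sigma> ^^ i) (coeff h (degree g + degree h - i)) =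
      (if i = degree g then lead_coeff g * (\<sigma> ^^ degree g) (lead_coeff h) else 0)"
    proof (cases i "degree g" rule: linorder_cases)
      case less
      then have "degree h < degree g + degree h - i" by linarith
      then show ?thesis using less by (simp add: coeff_eq_0)
    qed (auto simp: coeff_eq_0)
  qed simp
  then show ?thesis by simp
qed

lemma star_eq_0_iff [simp]: "g \<star> h = 0 \<longleftrightarrow> g = 0 \<or> h = 0"
  using coeff_star_top[of g h] by (metis coeff_0 leading_coeff_0_iff mult_eq_0_iff
      sigma_pow_eq_0_iff star_0)

lemma degree_star:
  assumes "g \<noteq> 0" "h \<noteq> 0"
  shows "degree (g \<star> h) = degree g + degree h"
proof (rule antisym)
  show "degree (g \<star> h) \<le> degree g + degree h"
    by (rule degree_le) (simp add: coeff_star_beyond)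
  show "degree g + degree h \<le> degree (g \<star> h)"
    using assms by (intro le_degree) (simp add: coeff_star_top)
qed

section \<open>Division with remainder and one-sided ideals\<close>

definition stable_subfield :: "'a set \<Rightarrow> bool" where
  "stable_subfield A \<longleftrightarrow> 1 \<in> A \<and> (\<forall>x\<in>A. \<forall>y\<in>A. x - y \<in> A \<and> x * y \<in> A) \<and>
     (\<forall>x\<in>A. inverse x \<in> A \<and> \<sigma> x \<in> A)"

lemma stable_subfield_UNIV: "stable_subfield UNIV"
  by (simp add: stable_subfield_def)

lemma stable_subfieldD:
  assumes "stable_subfield A"
  shows "0 \<in> A" "1 \<in> A" "x \<in> A \<Longrightarrow> y \<in> A \<Longrightarrow> x - y \<in> A" "x \<in> A \<Longrightarrow> y \<in> A \<Longrightarrow> x + y \<in> A"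
    "x \<in> A \<Longrightarrow> y \<in> A \<Longrightarrow> x * y \<in> A" "x \<in> A \<Longrightarrow> y \<in> A \<Longrightarrow> x / y \<in> A" "x \<in> A \<Longrightarrow> (\<sigma> ^^ i) x \<in> A"
proof -
  show 0: "0 \<in> A" using assms unfolding stable_subfield_def by (metis diff_self)
  show "x \<in> A \<Longrightarrow> y \<in> A \<Longrightarrow> x + y \<in> A"
    using assms 0 unfolding stable_subfield_def by (metis diff_0 diff_minus_eq_add)
  show "x \<in> A \<Longrightarrow> (\<sigma> ^^ i) x \<in> A"
    using assms by (induction i) (auto simp: stable_subfield_def)
qed (use assms in \<open>auto simp: stable_subfield_def divide_inverse\<close>)

lemma polys_over_closed:
  assumes "stable_subfield A"
  shows "0 \<in> polys_over A" "1 \<in> polys_over A"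
    "g \<in> polys_over A \<Longrightarrow> h \<in> polys_over A \<Longrightarrow> g + h \<in> polys_over A"
    "g \<in> polys_over A \<Longrightarrow> h \<in> polys_over A \<Longrightarrow> g - h \<in> polys_over A"
    "g \<in> polys_over A \<Longrightarrow> h \<in> polys_over A \<Longrightarrow> g \<star> h \<in> polys_over A"
    "c \<in> A \<Longrightarrow> monom c i \<in> polys_over A"
proof -
  have sum: "(\<And>i. i \<in> I \<Longrightarrow> u i \<in> A) \<Longrightarrow> sum u I \<in> A" for u :: "nat \<Rightarrow> 'a" and I
    by (induction I rule: infinite_finite_induct) (auto simp: stable_subfieldD[OF assms])
  show "g \<in> polys_over A \<Longrightarrow> h \<in> polys_over A \<Longrightarrow> g \<star> h \<in> polys_over A"
    by (auto simp: polys_over_def coeff_star intro!: sum stable_subfieldD[OF assms])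
qed (auto simp: polys_over_def stable_subfieldD[OF assms])

lemma polys_over_UNIV [simp]: "polys_over UNIV = UNIV"
  by (simp add: polys_over_def)

text \<open>
  The coefficients of quotient and remainder stay in \<open>A\<close>, because cancelling the leading term
  only divides by \<open>\<sigma>\<^sup>k\<close> of the leading coefficient of \<open>d\<close>.
\<close>

lemma right_division:
  assumes A: "stable_subfield A" and d: "d \<in> polys_over A" "d \<noteq> 0" and g: "g \<in> polys_over A"
  shows "\<exists>q\<in>polys_over A. \<exists>r\<in>polys_over A. g = q \<star> d + r \<and> (r = 0 \<or> degree r < degree d)"
proof -
  have "\<exists>q\<in>polys_over A. \<exists>r\<in>polys_over A. g = q \<star> d + r \<and> (r = 0 \<or> degree r < degree d)"
    if "\<forall>i\<ge>n. coeff g i = 0" "g \<in> polys_over A" for n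
    using that
  proof (induction n arbitrary: g)
    case 0
    then have "g = 0" by (intro poly_eqI) simp
    then show ?case using polys_over_closed(1)[OF A] by (auto intro!: bexI[of _ 0])
  next
    case (Suc n)
    show ?case
    proof (cases "n < degree d")
      case True
      have "degree g \<le> n"
        using Suc.prems(1) by (intro degree_le) auto
      then show ?thesis
        using True Suc.prems(2) polys_over_closed(1)[OF A]
        by (intro bexI[of _ 0] bexI[of _ g]) auto
    next
      case False
      define k where "k = n - degree d"
      define s where "s = monom (coeff g n / (\<sigma> ^^ k) (lead_coeff d)) k"
      have s: "s \<in> polys_over A"
        unfolding s_def using Suc.prems(2) d(1)
        by (intro polys_over_closed(6)[OF A] stable_subfieldD(6,7)[OF A])
          (simp_all add: polys_over_def)
      have "\<forall>i\<ge>n. coeff (g - s \<star> d) i = 0"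
      proof safe
        fix i assume "n \<le> i"
        then show "coeff (g - s \<star> d) i = 0"
        proof (cases "i = n")
          case True
          then show ?thesis using False d(2) by (simp add: s_def coeff_monom_star k_def)
        next
          case False
          with \<open>n \<le> i\<close> \<open>\<not> n < degree d\<close> have "degree d < i - k" "Suc n \<le> i"
            by (auto simp: k_def)
          then show ?thesis using Suc.prems(1) by (simp add: s_def coeff_monom_star coeff_eq_0)
        qed
      qed
      moreover have "g - s \<star> d \<in> polys_over A"
        by (intro polys_over_closed(4,5)[OF A] s d(1) Suc.prems(2))
      ultimately obtain q r where "q \<in> polys_over A" "r \<in> polys_over A"
        "g - s \<star> d = q \<star> d + r" "r = 0 \<or> degree r < degree d"
        using Suc.IH[of "g - s \<star> d"] by blast
      then show ?thesis
        using s polys_over_closed(3)[OF A]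
        by (intro bexI[of _ "q + s"] bexI[of _ r]) (simp_all add: star_add_left diff_eq_eq)
    qed
  qed
  from this[of "Suc (degree g)"] g show ?thesis by (auto simp: coeff_eq_0)
qed

text \<open>
  With the divisor on the left, the leading coefficient of the quotient is found by inverting a
  power of \<open>\<sigma>\<close>; this is where surjectivity of \<open>\<sigma>\<close> matters.
\<close>

lemma left_division:
  assumes d: "d \<noteq> 0"
  shows "\<exists>q r. g = d \<star> q + r \<and> (r = 0 \<or> degree r < degree d)"
proof -
  have "\<exists>q r. g = d \<star> q + r \<and> (r = 0 \<or> degree r < degree d)"
    if "\<forall>i\<ge>n. coeff g i = 0" for n
    using that
  proof (induction n arbitrary: g)
    case 0
    then have "g = d \<star> 0 + 0" by (intro poly_eqI) simp
    then show ?case by blast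
  next
    case (Suc n)
    show ?case
    proof (cases "n < degree d")
      case True
      have "degree g \<le> n"
        using Suc.prems(1) by (intro degree_le) auto
      then show ?thesis
        using True by (intro exI[of _ 0] exI[of _ g]) auto
    next
      case False
      define k where "k = n - degree d"
      obtain c where c: "(\<sigma> ^^ degree d) c = coeff g n / lead_coeff d"
        using bij_is_surj[OF bij_sigma_pow] by (metis surjD)
      define s where "s = monom c k"
      have "\<forall>i\<ge>n. coeff (g - d \<star> s) i = 0"
      proof safe
        fix i assume "n \<le> i"
        then show "coeff (g - d \<star> s) i = 0"
        proof (cases "i = n")
          case True
          then show ?thesis using False d by (simp add: s_def coeff_star_monom k_def c)
        next
          case False
          with \<open>n \<le> i\<close> \<open>\<not> n < degree d\<close> have "degree d < i - k" "Suc n \<le> i"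
            by (auto simp: k_def)
          then show ?thesis using Suc.prems(1) by (simp add: s_def coeff_star_monom coeff_eq_0)
        qed
      qed
      from Suc.IH[OF this] obtain q r where
        "g - d \<star> s = d \<star> q + r" "r = 0 \<or> degree r < degree d"
        by blast
      then show ?thesis
        by (intro exI[of _ "q + s"] exI[of _ r]) (simp add: star_add_right diff_eq_eq)
    qed
  qed
  from this[of "Suc (degree g)"] show ?thesis by (auto simp: coeff_eq_0)
qed

lemma left_ideal_principal:
  assumes A: "stable_subfield A" and L: "L \<subseteq> polys_over A" "0 \<in> L"
    and add: "\<And>x y. x \<in> L \<Longrightarrow> y \<in> L \<Longrightarrow> x + y \<in> L"
    and mult: "\<And>q x. q \<in> polys_over A \<Longrightarrow> x \<in> L \<Longrightarrow> q \<star> x \<in> L"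
  shows "\<exists>d\<in>L. \<forall>x\<in>L. \<exists>q\<in>polys_over A. x = q \<star> d"
proof (cases "L \<subseteq> {0}")
  case True
  then show ?thesis using L(2) polys_over_closed(1)[OF A] by fastforce
next
  case False
  then obtain x where "x \<in> L \<and> x \<noteq> 0" by auto
  then obtain d where d: "d \<in> L" "d \<noteq> 0"
    and min: "\<And>y. y \<in> L \<Longrightarrow> y \<noteq> 0 \<Longrightarrow> degree d \<le> degree y"
    using ex_has_least_nat[of "\<lambda>x. x \<in> L \<and> x \<noteq> 0" x degree] by blast
  have "\<exists>q\<in>polys_over A. x = q \<star> d" if "x \<in> L" for x
  proof -
    have "d \<in> polys_over A" "x \<in> polys_over A" using L(1) d(1) that by auto
    from right_division[OF A this(1) d(2) this(2)] obtain q r where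
      qr: "q \<in> polys_over A" "x = q \<star> d + r" "r = 0 \<or> degree r < degree d"
      by blast
    have "0 - q \<in> polys_over A"
      by (intro polys_over_closed(1,4)[OF A] qr(1))
    then have "x + (0 - q) \<star> d \<in> L"
      by (intro add[OF that] mult d(1))
    then have "r \<in> L" using qr(2) by (simp add: star_minus)
    then have "r = 0" using qr(3) min[of r] by fastforce
    then show ?thesis using qr by auto
  qed
  then show ?thesis using d(1) by blast
qed

text \<open>
  The left ideal \<open>R f\<close> of \<open>R = K[t;\<sigma>]\<close>. The coefficients of the multiplier range over \<open>K\<close> also
  in the statements about polynomials over a subfield: congruence modulo \<open>R f\<close> is enough there.
\<close>

definition lideal :: "'a poly \<Rightarrow> 'a poly set" where
  "lideal f = {q \<star> f | q. True}"

lemma lidealI: "q \<star> f \<in> lideal f"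
  by (auto simp: lideal_def)

lemma lidealE:
  assumes "x \<in> lideal f"
  obtains q where "x = q \<star> f"
  using assms by (auto simp: lideal_def)

lemma lideal_0: "0 \<in> lideal f"
  using lidealI[of 0 f] by simp

lemma lideal_self: "f \<in> lideal f"
  using lidealI[of 1 f] by simp

lemma lideal_star: "x \<in> lideal f \<Longrightarrow> q \<star> x \<in> lideal f"
  by (metis lidealI lidealE star_assoc)

lemma lideal_add: "x \<in> lideal f \<Longrightarrow> y \<in> lideal f \<Longrightarrow> x + y \<in> lideal f"
  by (metis lidealI lidealE star_add_left)

lemma lideal_diff: "x \<in> lideal f \<Longrightarrow> y \<in> lideal f \<Longrightarrow> x - y \<in> lideal f"
  by (metis lidealI lidealE star_diff_left)

lemma lideal_degree: "x \<in> lideal f \<Longrightarrow> x \<noteq> 0 \<Longrightarrow> degree f \<le> degree x"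
  by (auto elim!: lidealE simp: degree_star)

lemma lideal_trans: "x \<in> lideal f \<Longrightarrow> f \<in> lideal h \<Longrightarrow> x \<in> lideal h"
  by (metis lidealE lideal_star)

lemma lideal_same_degree:
  assumes "e \<in> lideal p" "e \<noteq> 0" "degree e \<le> degree p"
  shows "p \<in> lideal e"
proof -
  obtain c where c: "e = c \<star> p" using assms(1) by (rule lidealE)
  with assms have "degree c = 0" "c \<noteq> 0" by (auto simp: degree_star)
  then obtain a where a: "c = [:a:]" "a \<noteq> 0" by (metis degree_eq_zeroE pCons_0_0)
  have "[:inverse a:] \<star> c = 1"
    using a by (intro poly_eqI) (auto simp: coeff_const_star coeff_pCons split: nat.splits)
  then have "p = [:inverse a:] \<star> e" unfolding c by (simp flip: star_assoc)
  then show ?thesis by (metis lidealI)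
qed

lemma left_ideal_principal_UNIV:
  assumes "0 \<in> L" "\<And>x y. x \<in> L \<Longrightarrow> y \<in> L \<Longrightarrow> x + y \<in> L" "\<And>q x. x \<in> L \<Longrightarrow> q \<star> x \<in> L"
  shows "\<exists>d. L = lideal d"
proof -
  have "\<exists>d\<in>L. \<forall>x\<in>L. \<exists>q\<in>polys_over UNIV. x = q \<star> d"
    using assms by (intro left_ideal_principal[OF stable_subfield_UNIV]) auto
  then obtain d where "d \<in> L" "\<And>x. x \<in> L \<Longrightarrow> x \<in> lideal d" by (metis lidealI)
  then show ?thesis using assms(3) by (intro exI[of _ d]) (auto elim: lidealE)
qed

text \<open>
  The left ideal generated by \<open>y\<close> and \<open>f\<close> in \<open>A[t;\<sigma>]\<close> has a single generator \<open>d\<close>, a right factor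
  of \<open>f\<close>. Irreducibility makes \<open>d\<close> either a unit or an associate of \<open>f\<close>, and in the second
  case \<open>y\<close> would be a left multiple of \<open>f\<close>.
\<close>

lemma irreducible_left_inverse:
  assumes A: "stable_subfield A" and f: "f \<in> polys_over A" "f \<noteq> 0"
    and irred: "\<And>g h. g \<in> polys_over A \<Longrightarrow> h \<in> polys_over A \<Longrightarrow> f = g \<star> h \<Longrightarrow>
      degree f \<le> degree g \<or> degree f \<le> degree h"
    and y: "y \<in> polys_over A" "y \<notin> lideal f"
  shows "\<exists>b\<in>polys_over A. \<exists>c\<in>polys_over A. b \<star> y + c \<star> f = 1"
proof -
  define L where "L = {b \<star> y + c \<star> f | b c. b \<in> polys_over A \<and> c \<in> polys_over A}"
  have LI: "b \<star> y + c \<star> f \<in> L" if "b \<in> polys_over A" "c \<in> polys_over A" for b c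
    using that unfolding L_def by blast
  have LE: "\<exists>b\<in>polys_over A. \<exists>c\<in>polys_over A. x = b \<star> y + c \<star> f" if "x \<in> L" for x
    using that unfolding L_def by blast
  note closed = polys_over_closed[OF A]
  have mult: "q \<star> x \<in> L" if "q \<in> polys_over A" "x \<in> L" for q x
  proof -
    obtain b c where bc: "b \<in> polys_over A" "c \<in> polys_over A" "x = b \<star> y + c \<star> f"
      using LE \<open>x \<in> L\<close> by blast
    have "q \<star> x = (q \<star> b) \<star> y + (q \<star> c) \<star> f" by (simp add: bc star_add_right star_assoc)
    then show ?thesis using LI[OF closed(5,5), OF that(1) bc(1) that(1) bc(2)] by simp
  qed
  have "\<exists>d\<in>L. \<forall>x\<in>L. \<exists>q\<in>polys_over A. x = q \<star> d"
  proof (rule left_ideal_principal[OF A])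
    show "L \<subseteq> polys_over A"
    proof
      fix x assume "x \<in> L"
      then obtain b c where "b \<in> polys_over A" "c \<in> polys_over A" "x = b \<star> y + c \<star> f"
        using LE by blast
      then show "x \<in> polys_over A" using closed(3,5) f y by simp
    qed
    show "0 \<in> L" using LI[OF closed(1,1)] by simp
    show "x1 + x2 \<in> L" if "x1 \<in> L" "x2 \<in> L" for x1 x2
    proof -
      obtain b c where bc: "b \<in> polys_over A" "c \<in> polys_over A" "x1 = b \<star> y + c \<star> f"
        using LE \<open>x1 \<in> L\<close> by blast
      obtain b' c' where bc': "b' \<in> polys_over A" "c' \<in> polys_over A" "x2 = b' \<star> y + c' \<star> f"
        using LE \<open>x2 \<in> L\<close> by blast
      have "x1 + x2 = (b + b') \<star> y + (c + c') \<star> f" by (simp add: bc bc' star_add_left)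
      then show ?thesis using LI[OF closed(3,3), OF bc(1) bc'(1) bc(2) bc'(2)] by simp
    qed
  qed (rule mult)
  then obtain d where d: "d \<in> L" and gen: "\<And>x. x \<in> L \<Longrightarrow> \<exists>q\<in>polys_over A. x = q \<star> d"
    by blast
  have dA: "d \<in> polys_over A"
    using LE[OF d] closed(3,5) f(1) y(1) by auto
  obtain e where e: "e \<in> polys_over A" "f = e \<star> d"
    using gen[OF LI[OF closed(1,2)]] by auto
  have yd: "y \<in> lideal d"
    using gen[OF LI[OF closed(2,1)]] lidealI by auto
  have nz: "e \<noteq> 0" "d \<noteq> 0" using e f(2) by auto
  have "\<not> degree f \<le> degree d"
    using lideal_same_degree[of f d] lidealI[of e d] lideal_trans[OF yd] e f(2) y(2) by metis
  then have "degree f \<le> degree e" using irred[OF e(1) dA e(2)] by blast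
  then have "degree d = 0" using e(2) nz by (simp add: degree_star)
  then obtain a where a: "d = [:a:]" "a \<noteq> 0" using nz(2) by (metis degree_eq_zeroE pCons_0_0)
  have "coeff d 0 \<in> A" using dA unfolding polys_over_def by blast
  then have "monom (1 / a) 0 \<in> polys_over A"
    using a by (intro closed(6) stable_subfieldD[OF A]) auto
  moreover have "monom (1 / a) 0 \<star> d = 1"
    using a by (intro poly_eqI) (auto simp: coeff_monom_star coeff_pCons split: nat.splits)
  ultimately have "1 \<in> L" using mult d by metis
  then show ?thesis using LE by metis
qed

text \<open>
  A nonconstant right factor of least degree is irreducible, which is expressed here by the
  property that is used later: \<open>R h\<close> is a maximal left ideal.
\<close>

lemma exists_irreducible_right_factor:
  assumes f: "f \<in> lideal h0" "degree h0 > 0"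
  shows "\<exists>h. f \<in> lideal h \<and> 0 < degree h \<and> degree h \<le> degree h0 \<and>
    (\<forall>u. u \<notin> lideal h \<longrightarrow> (\<exists>b c. b \<star> u + c \<star> h = 1))"
proof -
  obtain h where h: "f \<in> lideal h" "degree h > 0"
    and min: "\<And>d. f \<in> lideal d \<Longrightarrow> degree d > 0 \<Longrightarrow> degree h \<le> degree d"
    using ex_has_least_nat[of "\<lambda>h. f \<in> lideal h \<and> degree h > 0" h0 degree] f by blast
  have h0: "h \<noteq> 0" using h(2) by auto
  have "degree h \<le> degree g \<or> degree h \<le> degree d" if gd: "h = g \<star> d" for g d
  proof (cases "degree d = 0")
    case True
    then show ?thesis using gd h0 by (simp add: degree_star)
  next
    case False
    have "f \<in> lideal d" using lideal_trans[OF h(1)] lidealI gd by metis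
    then show ?thesis using min False by blast
  qed
  then have "\<exists>b c. b \<star> u + c \<star> h = 1" if "u \<notin> lideal h" for u
    using irreducible_left_inverse[OF stable_subfield_UNIV, of h u] h0 that by auto
  then show ?thesis using h min[of h0] f by blast
qed

section \<open>Simple quotients of a bounded cyclic module\<close>

text \<open>
  An element \<open>y\<close> with \<open>h y \<in> R f\<close> and \<open>y \<notin> R f\<close> is the image of \<open>1\<close> under a nonzero homomorphism
  from the simple module \<open>S = R/Rh\<close> to \<open>M = R/Rf\<close>. Suppose that there is none.

  For a finite set \<open>A\<close> let \<open>L A\<close> be the annihilator of the classes of \<open>A\<close> in \<open>S\<close>. Then \<open>R/L A\<close>
  embeds in a finite power of \<open>S\<close>, so it is a sum of copies of \<open>S\<close> and has no nonzero homomorphism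
  to \<open>M\<close> either: an element of \<open>M\<close> killed by \<open>L A\<close> is zero (\<open>L_faithful\<close>). The annihilator of the
  whole of \<open>S\<close> is a two-sided ideal \<open>R p\<close>. It is nonzero because \<open>f\<close> is bounded, and so by counting
  degrees it equals \<open>L A\<close> for some finite \<open>A\<close>. Consequently \<open>p\<close> acts injectively on \<open>M\<close>.
  But a generator \<open>z\<close> of the annihilator of \<open>M\<close> also kills \<open>S\<close>, which gives \<open>z = p q\<close>; by
  injectivity of \<open>p\<close> the element \<open>q\<close> kills \<open>M\<close>, although its degree is less than that of \<open>z\<close>.
\<close>

lemma exists_hom_from_simple_quotient:
  assumes f: "f \<in> lideal h" and h: "degree h > 0"
    and max: "\<And>u. u \<notin> lideal h \<Longrightarrow> \<exists>b c. b \<star> u + c \<star> h = 1"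
    and bdd: "x0 \<noteq> 0" "\<And>r. x0 \<star> r \<in> lideal f"
  shows "\<exists>y. y \<notin> lideal f \<and> h \<star> y \<in> lideal f"
proof (rule ccontr)
  assume "\<not> ?thesis"
  then have inj: "y \<in> lideal f" if "h \<star> y \<in> lideal f" for y using that by blast
  define L where "L A = {a. \<forall>r\<in>A. a \<star> r \<in> lideal h}" for A
  have L_ideal: "\<exists>d. L A = lideal d" for A
    by (rule left_ideal_principal_UNIV)
      (auto simp: L_def lideal_0 star_add_left star_assoc lideal_add lideal_star)
  have L_star: "q \<star> a \<in> L A" if "a \<in> L A" for q a A
    using that by (auto simp: L_def star_assoc lideal_star)
  have L_faithful: "x \<in> lideal f" if "finite A" "\<forall>a\<in>L A. a \<star> x \<in> lideal f" for A x
    using that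
  proof (induction A)
    case empty
    then have "1 \<star> x \<in> lideal f" unfolding L_def by blast
    then show ?case by simp
  next
    case (insert r A)
    show ?case
    proof (rule ccontr)
      assume "x \<notin> lideal f"
      then obtain a where a: "a \<in> L A" "a \<star> x \<notin> lideal f" using insert.IH by blast
      have "a \<star> r \<notin> lideal h"
        using a insert.prems by (auto simp: L_def)
      then obtain b c where bc: "b \<star> (a \<star> r) + c \<star> h = 1" using max by blast
      then have bar: "b \<star> (a \<star> r) = 1 - c \<star> h" by (simp add: eq_diff_eq)
      \<comment> \<open>The class of \<open>b a r\<close> in \<open>S\<close> is that of \<open>1\<close>, so \<open>1 \<mapsto> b a x\<close> is a homomorphism from \<open>S\<close>
        to \<open>M\<close>, hence zero.\<close>
      have "h \<star> b \<star> a \<star> r = (1 - h \<star> c) \<star> h"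
        by (simp add: star_assoc bar star_diff_right star_diff_left)
      then have "h \<star> b \<star> a \<in> L (insert r A)"
        using L_star[OF a(1), of "h \<star> b"] by (simp add: L_def lidealI)
      then have "h \<star> (b \<star> (a \<star> x)) \<in> lideal f"
        using insert.prems by (metis star_assoc)
      then have y: "b \<star> (a \<star> x) \<in> lideal f" by (rule inj)
      \<comment> \<open>The element \<open>a r b a\<close> acts on \<open>r\<close> in \<open>S\<close> as \<open>a\<close> does, so \<open>a x = a r (b a x) = 0\<close> in \<open>M\<close>.\<close>
      define e where "e = a \<star> r \<star> b \<star> a - a"
      have "e = (a \<star> r \<star> b - 1) \<star> a" by (simp add: e_def star_diff_left)
      then have "e \<in> L A" using L_star[OF a(1)] by simp
      moreover have "e \<star> r = (- (a \<star> r \<star> c)) \<star> h"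
        by (simp add: e_def star_diff_left star_assoc bar star_diff_right star_minus)
      ultimately have "e \<in> L (insert r A)" by (simp add: L_def lidealI)
      then have "e \<star> x \<in> lideal f" using insert.prems by blast
      moreover have "a \<star> x = a \<star> r \<star> (b \<star> (a \<star> x)) - e \<star> x"
        by (simp add: e_def star_diff_left star_assoc)
      ultimately have "a \<star> x \<in> lideal f" using lideal_diff lideal_star[OF y] by metis
      then show False using a(2) by simp
    qed
  qed
  have x0: "x0 \<in> L A" for A
    using lideal_trans[OF bdd(2) f] by (simp add: L_def)
  \<comment> \<open>Enlarging \<open>A\<close> never lowers the degree of the generator of \<open>L A\<close>, which is at most \<open>degree x0\<close>;
    a generator of greatest degree therefore annihilates all of \<open>S\<close>.\<close>
  define good where "good = (\<lambda>(A, p). finite A \<and> L A = lideal p)"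
  have bound: "p \<noteq> 0 \<and> degree p \<le> degree x0" if "good (A, p)" for A p
    using x0[of A] bdd(1) lideal_degree[of x0 p] that by (auto simp: good_def elim: lidealE)
  obtain p0 where "good ({}, p0)"
    using L_ideal[of "{}"] by (auto simp: good_def)
  then have "\<exists>Ap. good Ap \<and> (\<forall>Bq. good Bq \<longrightarrow> degree (snd Bq) \<le> degree (snd Ap))"
    using bound by (intro ex_has_greatest_nat[where b = "Suc (degree x0)"]) (auto simp: less_Suc_eq_le)
  then obtain A p where Ap: "good (A, p)"
    and great: "\<And>B q. good (B, q) \<Longrightarrow> degree q \<le> degree p" by fastforce
  have LA: "finite A" "L A = lideal p" using Ap by (auto simp: good_def)
  have p0: "p \<noteq> 0" using bound Ap by blast
  have p_ann: "p \<star> r \<in> lideal h" for r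
  proof -
    obtain e where e: "L (insert r A) = lideal e" using L_ideal by blast
    then have ge: "good (insert r A, e)" using LA by (simp add: good_def)
    have "e \<in> L A" using e lideal_self[of e] by (auto simp: L_def)
    then have "p \<in> lideal e"
      using lideal_same_degree[of e p] bound[OF ge] great[OF ge] LA(2) by blast
    then show ?thesis using e by (auto simp: L_def)
  qed
  have ann_iff: "a \<in> lideal p \<longleftrightarrow> (\<forall>r. a \<star> r \<in> lideal h)" for a
  proof
    show "a \<in> lideal p" if "\<forall>r. a \<star> r \<in> lideal h"
      using that LA(2) by (auto simp: L_def)
    show "\<forall>r. a \<star> r \<in> lideal h" if "a \<in> lideal p"
      using that p_ann by (metis lidealE lideal_star star_assoc)
  qed
  have two_sided: "a \<star> s \<in> lideal p" if "a \<in> lideal p" for a s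
    using that unfolding ann_iff by (auto simp: star_assoc)
  have p_inj: "x \<in> lideal f" if "p \<star> x \<in> lideal f" for x
    using L_faithful[OF LA(1), of x] that unfolding LA(2)
    by (metis lidealE lideal_star star_assoc)
  have degp: "degree p > 0"
    using lideal_degree[of p h] p_ann[of 1] p0 h by simp
  obtain z where z: "z \<noteq> 0" "\<And>r. z \<star> r \<in> lideal f"
    and z_min: "\<And>x. x \<noteq> 0 \<Longrightarrow> \<forall>r. x \<star> r \<in> lideal f \<Longrightarrow> degree z \<le> degree x"
    using ex_has_least_nat[of "\<lambda>z. z \<noteq> 0 \<and> (\<forall>r. z \<star> r \<in> lideal f)" x0 degree] bdd by blast
  \<comment> \<open>Knowing \<open>z \<in> R p\<close>, the factor \<open>p\<close> has to be moved to the left: the remainder of the left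
    division lies in \<open>R p\<close>, as this ideal is two-sided, and it is too small to be nonzero.\<close>
  obtain q e where qe: "z = p \<star> q + e" "e = 0 \<or> degree e < degree p"
    using left_division[OF p0] by blast
  have "z \<in> lideal p" unfolding ann_iff using lideal_trans[OF z(2) f] by blast
  then have "z - p \<star> q \<in> lideal p"
    using two_sided[OF lideal_self] lideal_diff by blast
  then have "e \<in> lideal p" using qe(1) by simp
  then have "e = 0" using qe(2) lideal_degree[of e p] by linarith
  then have zq: "z = p \<star> q" using qe by simp
  have "q \<star> r \<in> lideal f" for r
    using p_inj[of "q \<star> r"] z(2)[of r] by (simp add: zq star_assoc)
  moreover have "q \<noteq> 0" using z(1) zq by auto
  ultimately have "degree z \<le> degree q" using z_min by blast
  then show False using zq degp p0 \<open>q \<noteq> 0\<close> by (simp add: degree_star)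
qed

section \<open>Nuclei of the Petit algebra\<close>

abbreviation R :: "'a poly ring" where
  "R \<equiv> skew_poly_ring \<sigma> UNIV"

abbreviation rem :: "'a poly \<Rightarrow> 'a poly \<Rightarrow> 'a poly" where
  "rem f g \<equiv> right_rem R f g"

lemma left_multiples_eq_lideal: "left_multiples R f = lideal f"
  by (simp add: left_multiples_def lideal_def skew_poly_ring_def)

lemma right_rem_eqI:
  assumes "f \<noteq> 0" "r = 0 \<or> degree r < degree f" "g - r \<in> lideal f"
  shows "rem f g = r"
  unfolding right_rem_def
proof (rule the_equality)
  obtain q where q: "g - r = q \<star> f" using assms(3) by (rule lidealE)
  then have "g = q \<star> f + r" by (simp add: diff_eq_eq)
  then show "r \<in> carrier R \<and> (r = 0 \<or> degree r < degree f) \<and>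
      (\<exists>q\<in>carrier R. g = q \<otimes>\<^bsub>R\<^esub> f \<oplus>\<^bsub>R\<^esub> r)"
    using assms(2) by (auto simp: skew_poly_ring_def)
  fix s assume "s \<in> carrier R \<and> (s = 0 \<or> degree s < degree f) \<and>
      (\<exists>q\<in>carrier R. g = q \<otimes>\<^bsub>R\<^esub> f \<oplus>\<^bsub>R\<^esub> s)"
  then obtain q' where s: "s = 0 \<or> degree s < degree f" and q': "g = q' \<star> f + s"
    by (auto simp: skew_poly_ring_def)
  have "s - r = (g - r) - q' \<star> f" using q' by simp
  then have "s - r \<in> lideal f" using assms(3) lidealI lideal_diff by metis
  moreover have "s - r = 0 \<or> degree (s - r) < degree f"
    using s assms(2) by (metis cancel_comm_monoid_add_class.diff_cancel degree_diff_less
        diff_0 diff_zero degree_minus)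
  ultimately show "s = r" using lideal_degree[of "s - r" f] by force
qed

lemma
  assumes "f \<noteq> 0"
  shows right_rem_degree: "rem f g = 0 \<or> degree (rem f g) < degree f"
    and right_rem_cong: "g - rem f g \<in> lideal f"
proof -
  obtain q r where qr: "g = q \<star> f + r" "r = 0 \<or> degree r < degree f"
    using right_division[OF stable_subfield_UNIV _ assms, of g] by auto
  moreover have "g - r \<in> lideal f" using lidealI[of q f] qr(1) by simp
  ultimately have "rem f g = r" by (intro right_rem_eqI[OF assms])
  then show "rem f g = 0 \<or> degree (rem f g) < degree f" "g - rem f g \<in> lideal f"
    using qr(2) \<open>g - r \<in> lideal f\<close> by auto
qed

lemma right_rem_eq_iff:
  assumes f: "f \<noteq> 0"
  shows "rem f a = rem f b \<longleftrightarrow> a - b \<in> lideal f"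
proof
  assume "rem f a = rem f b"
  then have "a - b = (a - rem f a) - (b - rem f b)" by simp
  then show "a - b \<in> lideal f" using right_rem_cong[OF f] lideal_diff by metis
next
  assume "a - b \<in> lideal f"
  then have "(a - b) + (b - rem f b) \<in> lideal f"
    by (intro lideal_add right_rem_cong[OF f])
  then show "rem f a = rem f b"
    by (intro right_rem_eqI[OF f] right_rem_degree[OF f]) simp
qed

text \<open>
  Reducing the inner product on the right changes the outer product by a left multiple of \<open>f\<close>,
  whereas on the left the multiple of \<open>f\<close> that is dropped gets multiplied by \<open>z\<close> from the right;
  this is the only obstruction to associativity.
\<close>

lemma petit_assoc_iff:
  assumes f: "f \<noteq> 0"
  shows "rem f (rem f (x \<star> y) \<star> z) = rem f (x \<star> rem f (y \<star> z)) \<longleftrightarrow>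
    (x \<star> y - rem f (x \<star> y)) \<star> z \<in> lideal f"
proof -
  define d where "d = (x \<star> y - rem f (x \<star> y)) \<star> z"
  define e where "e = x \<star> (y \<star> z - rem f (y \<star> z))"
  have e: "e \<in> lideal f" unfolding e_def by (intro lideal_star right_rem_cong[OF f])
  have eq: "rem f (x \<star> y) \<star> z - x \<star> rem f (y \<star> z) = e - d"
    by (simp add: d_def e_def star_diff_left star_diff_right star_assoc)
  have "e - d \<in> lideal f \<longleftrightarrow> d \<in> lideal f"
    using lideal_diff[OF e, of d] lideal_diff[OF e, of "e - d"] by auto
  then show ?thesis unfolding right_rem_eq_iff[OF f] eq d_def[symmetric] .
qed

lemma Nuc_r_petit_if:
  assumes f: "f \<noteq> 0" and x: "x = 0 \<or> degree x < degree f" and fx: "f \<star> x \<in> lideal f"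
  shows "x \<in> Nuc_r (petit_algebra \<sigma> UNIV f)"
proof -
  have "(y \<star> z - rem f (y \<star> z)) \<star> x \<in> lideal f" for y z
    using right_rem_cong[OF f, of "y \<star> z"] fx
    by (auto elim!: lidealE[of "y \<star> z - _"] simp: star_assoc intro: lideal_star)
  then show ?thesis
    using x petit_assoc_iff[OF f] by (simp add: Nuc_r_def petit_algebra_def del: star_0)
qed

text \<open>
  Multiplication by a constant does not raise degrees, so constants are always in the left and
  middle nucleus and only the right nucleus imposes a condition. The condition is necessary
  because \<open>t\<^sup>m\<^sup>-\<^sup>1 t\<close> differs from its remainder by exactly \<open>f\<close>.
\<close>

lemma nucleus_field_iff:
  assumes monic: "lead_coeff f = 1" and deg: "degree f \<ge> 2"
  shows "a \<in> nucleus_field \<sigma> f \<longleftrightarrow> f \<star> [:a:] \<in> lideal f"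
proof
  let ?S = "petit_algebra \<sigma> UNIV f" and ?m = "degree f"
  have f: "f \<noteq> 0" using monic by auto
  show "f \<star> [:a:] \<in> lideal f" if "a \<in> nucleus_field \<sigma> f"
  proof -
    define y :: "'a poly" where "y = monom 1 (?m - 1)"
    define t :: "'a poly" where "t = monom 1 1"
    have yt: "y \<star> t = monom 1 ?m"
      using deg by (intro poly_eqI) (auto simp: y_def t_def coeff_monom_star)
    have "degree y < ?m" "degree t < ?m"
      using deg by (auto simp: y_def t_def degree_monom_eq)
    then have "rem f (rem f (y \<star> t) \<star> [:a:]) = rem f (y \<star> rem f (t \<star> [:a:]))"
      using that by (simp add: nucleus_field_def Nuc_def Nuc_r_def petit_algebra_def)
    then have "(monom 1 ?m - rem f (monom 1 ?m)) \<star> [:a:] \<in> lideal f"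
      using petit_assoc_iff[OF f, of y t "[:a:]"] by (simp add: yt)
    moreover have "rem f (monom 1 ?m) = monom 1 ?m - f"
    proof (rule right_rem_eqI[OF f])
      have "degree (monom 1 ?m - f) < ?m"
      proof (rule degree_lessI)
        show "monom 1 ?m - f \<noteq> 0 \<or> 0 < ?m" using deg by simp
        show "\<forall>k\<ge>?m. coeff (monom 1 ?m - f) k = 0"
          using monic by (auto simp: coeff_eq_0 le_less)
      qed
      then show "monom 1 ?m - f = 0 \<or> degree (monom 1 ?m - f) < ?m" ..
    qed (simp add: lideal_self)
    ultimately show ?thesis by simp
  qed
  show "a \<in> nucleus_field \<sigma> f" if "f \<star> [:a:] \<in> lideal f"
  proof -
    have small: "rem f g = g" if "g = 0 \<or> degree g < ?m" for g
      using that by (intro right_rem_eqI[OF f]) (auto simp: lideal_0)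
    have "degree ([:a:] \<star> g) \<le> degree g" "degree (g \<star> [:a:]) \<le> degree g" for g
      by (auto intro!: degree_le simp: coeff_const_star coeff_star_const coeff_eq_0)
    then have "degree g < ?m \<Longrightarrow> rem f ([:a:] \<star> g) = [:a:] \<star> g"
      "degree g < ?m \<Longrightarrow> rem f (g \<star> [:a:]) = g \<star> [:a:]" for g
      by (meson small le_less_trans)+
    then have *: "g = 0 \<or> degree g < ?m \<Longrightarrow> rem f ([:a:] \<star> g) = [:a:] \<star> g"
      "g = 0 \<or> degree g < ?m \<Longrightarrow> rem f (g \<star> [:a:]) = g \<star> [:a:]" for g
      using small[of 0] by auto
    have "[:a:] \<in> carrier ?S" using deg by (auto simp: petit_algebra_def)
    moreover have "[:a:] \<in> Nuc_r ?S"
      using deg by (intro Nuc_r_petit_if[OF f _ that]) auto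
    moreover have "rem f (rem f ([:a:] \<star> y) \<star> z) = rem f ([:a:] \<star> rem f (y \<star> z))"
      "rem f (rem f (y \<star> [:a:]) \<star> z) = rem f (y \<star> rem f ([:a:] \<star> z))"
      if "y = 0 \<or> degree y < ?m" for y z
      unfolding petit_assoc_iff[OF f] by (simp_all add: *[OF that] lideal_0)
    ultimately show ?thesis
      using small[of 0]
      by (simp add: nucleus_field_def Nuc_def Nuc_l_def Nuc_m_def petit_algebra_def)
  qed
qed

text \<open>
  Comparing degrees, \<open>f a = q f\<close> forces \<open>q\<close> to be constant; the leading coefficient then gives
  \<open>q = \<sigma>\<^sup>m(a)\<close>, and the other coefficients give the stated equations. In this form it is visible
  that these \<open>a\<close> form a \<open>\<sigma>\<close>-stable field.
\<close>

lemma const_idealizer_iff: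
  assumes monic: "lead_coeff f = 1"
  shows "f \<star> [:a:] \<in> lideal f \<longleftrightarrow> (\<forall>i. coeff f i \<noteq> 0 \<longrightarrow> (\<sigma> ^^ i) a = (\<sigma> ^^ degree f) a)"
proof
  assume "f \<star> [:a:] \<in> lideal f"
  then obtain q where q: "f \<star> [:a:] = q \<star> f" by (rule lidealE)
  have "degree q = 0"
  proof (cases "a = 0")
    case False
    then have "q \<star> f \<noteq> 0" using q monic by (metis leading_coeff_0_iff pCons_eq_0_iff
        star_eq_0_iff zero_neq_one)
    then have "degree f + degree [:a:] = degree q + degree f"
      using False q by (metis degree_star star_eq_0_iff)
    then show ?thesis by simp
  qed (use q monic in auto)
  then obtain c where c: "q = [:c:]" by (rule degree_eq_zeroE)
  have eq: "coeff f i * (\<sigma> ^^ i) a = c * coeff f i" for i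
    using arg_cong[OF q, of "\<lambda>p. coeff p i"] by (simp add: c coeff_const_star coeff_star_const)
  show "\<forall>i. coeff f i \<noteq> 0 \<longrightarrow> (\<sigma> ^^ i) a = (\<sigma> ^^ degree f) a"
    using eq[of "degree f"] eq monic by auto
next
  assume "\<forall>i. coeff f i \<noteq> 0 \<longrightarrow> (\<sigma> ^^ i) a = (\<sigma> ^^ degree f) a"
  then have "f \<star> [:a:] = [:(\<sigma> ^^ degree f) a:] \<star> f"
    by (intro poly_eqI) (auto simp: coeff_const_star coeff_star_const)
  then show "f \<star> [:a:] \<in> lideal f" by (metis lidealI)
qed

lemma stable_subfield_nucleus_field:
  assumes "lead_coeff f = 1" "degree f \<ge> 2"
  shows "stable_subfield (nucleus_field \<sigma> f)"
proof -
  have "(\<sigma> ^^ i) (\<sigma> a) = \<sigma> ((\<sigma> ^^ i) a)" for i a by (simp add: funpow_swap1)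
  then show ?thesis
    unfolding stable_subfield_def
    by (auto simp: nucleus_field_iff[OF assms] const_idealizer_iff[OF assms(1)]
        sigma_pow_diff sigma_pow_mult sigma_pow_inverse)
qed

lemma sigma_pow_fixed: "a \<in> fixed_field \<sigma> \<Longrightarrow> (\<sigma> ^^ i) a = a"
  by (induction i) (auto simp: fixed_field_def)

lemma fixed_field_subset_nucleus_field:
  assumes "lead_coeff f = 1" "degree f \<ge> 2"
  shows "fixed_field \<sigma> \<subseteq> nucleus_field \<sigma> f"
  using sigma_pow_fixed by (auto simp: nucleus_field_iff[OF assms] const_idealizer_iff[OF assms(1)])

text \<open>
  For \<open>a\<close> in the nucleus \<open>f a = \<sigma>\<^sup>m(a) f\<close>, and \<open>f\<close> commutes with \<open>t\<close> since its coefficients are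
  fixed by \<open>\<sigma>\<close>. So \<open>f u = u' f\<close>, where \<open>u'\<close> arises from \<open>u\<close> by applying \<open>\<sigma>\<^sup>m\<close> to the coefficients.
\<close>

lemma star_nucleus_polys:
  assumes "lead_coeff f = 1" "degree f \<ge> 2" "f \<in> polys_over (fixed_field \<sigma>)"
    and u: "u \<in> polys_over (nucleus_field \<sigma> f)"
  shows "f \<star> u \<in> lideal f"
proof -
  let ?u = "map_poly (\<sigma> ^^ degree f) u"
  have "f \<star> u = ?u \<star> f"
  proof (rule poly_eqI)
    fix n
    have "coeff (f \<star> u) n = (\<Sum>i\<le>n. coeff f i * (\<sigma> ^^ degree f) (coeff u (n - i)))"
      unfolding coeff_star
    proof (rule sum.cong)
      fix i
      have "coeff u (n - i) \<in> nucleus_field \<sigma> f" using u by (simp add: polys_over_def)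
      then show "coeff f i * (\<sigma> ^^ i) (coeff u (n - i)) =
          coeff f i * (\<sigma> ^^ degree f) (coeff u (n - i))"
        unfolding nucleus_field_iff[OF assms(1,2)] const_idealizer_iff[OF assms(1)] by auto
    qed simp
    also have "\<dots> = (\<Sum>i\<le>n. coeff f (n - i) * (\<sigma> ^^ degree f) (coeff u i))"
      by (rule sum.reindex_bij_witness[where i = "\<lambda>i. n - i" and j = "\<lambda>i. n - i"]) auto
    also have "\<dots> = coeff (?u \<star> f) n"
      using assms(3) sigma_pow_fixed
      by (simp add: coeff_star coeff_map_poly polys_over_def mult.commute)
    finally show "coeff (f \<star> u) n = coeff (?u \<star> f) n" .
  qed
  then show ?thesis by (metis lidealI)
qed

section \<open>Irreducibility over the nucleus and over the whole field\<close>

lemma not_Units: "degree p > 0 \<Longrightarrow> p \<notin> Units (skew_poly_ring \<sigma> A)"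
proof
  assume p: "degree p > 0" "p \<in> Units (skew_poly_ring \<sigma> A)"
  then obtain q where q: "q \<star> p = 1" by (auto simp: Units_def skew_poly_ring_def)
  then have "q \<star> p \<noteq> 0" by simp
  then have "degree (q \<star> p) = degree q + degree p" by (simp add: degree_star)
  then show False using p q by simp
qed

lemma skew_irreducible_iff:
  assumes "degree p > 0"
  shows "skew_irreducible (skew_poly_ring \<sigma> A) p \<longleftrightarrow> p \<in> polys_over A \<and>
    (\<forall>g\<in>polys_over A. \<forall>h\<in>polys_over A. p = g \<star> h \<longrightarrow>
      degree p \<le> degree g \<or> degree p \<le> degree h)"
  using not_Units[OF assms, of A]
  by (auto simp: skew_irreducible_def skew_poly_ring_def not_less)

lemma bounded_elemD:
  assumes "bounded_elem R f"
  shows "\<exists>x. x \<noteq> 0 \<and> (\<forall>r. x \<star> r \<in> lideal f)"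
proof -
  obtain x where x: "x \<noteq> 0" "ideal (lideal x) R" "lideal x \<subseteq> lideal f"
    using assms unfolding bounded_elem_def left_multiples_eq_lideal
    by (auto simp: skew_poly_ring_def)
  have "x \<star> r \<in> lideal x" for r
    using ideal.I_r_closed[OF x(2) lideal_self, of r] by (simp add: skew_poly_ring_def)
  then show ?thesis using x by blast
qed

text \<open>
  By \<open>invariant\<close>, right multiplication by elements of \<open>B\<close> is well defined modulo \<open>R f\<close>, so the
  usual argument for associative rings applies: if \<open>b\<close> is a left inverse of \<open>y\<close> and \<open>b'\<close> one of \<open>b\<close>, then \<open>y = b' b y = b'\<close>.
\<close>

lemma right_inverse_of_left_inverses:
  assumes f: "degree f > 0"
    and inv: "\<And>v. v \<in> B \<Longrightarrow> v \<notin> lideal f \<Longrightarrow> \<exists>b\<in>B. \<exists>c. b \<star> v + c \<star> f = 1"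
    and invariant: "\<And>v. v \<in> B \<Longrightarrow> f \<star> v \<in> lideal f"
    and y: "y \<in> B" "y \<notin> lideal f"
  shows "\<exists>b\<in>B. y \<star> b - 1 \<in> lideal f"
proof -
  have star_B: "x \<star> v \<in> lideal f" if "x \<in> lideal f" "v \<in> B" for x v
    using that invariant by (metis lidealE lideal_star star_assoc)
  obtain b c where b: "b \<in> B" "b \<star> y + c \<star> f = 1" using inv[OF y] by blast
  have "b \<notin> lideal f"
  proof
    assume "b \<in> lideal f"
    then have "1 \<in> lideal f"
      using lideal_add[OF star_B[OF _ y(1)] lidealI[of c f], of b] b(2) by simp
    then show False using lideal_degree[of 1 f] f by simp
  qed
  then obtain b' c' where b': "b' \<star> b + c' \<star> f = 1" using inv[OF b(1)] by blast
  have by_eq: "b \<star> y = 1 - c \<star> f" and bb_eq: "b' \<star> b = 1 - c' \<star> f"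
    using b(2) b' by (simp_all add: eq_diff_eq)
  have "y - b' = c' \<star> (f \<star> y) - b' \<star> c \<star> f"
  proof -
    have "y = (b' \<star> b + c' \<star> f) \<star> y" using b' by simp
    also have "\<dots> = b' \<star> (b \<star> y) + c' \<star> (f \<star> y)" by (simp add: star_add_left star_assoc)
    finally show ?thesis by (simp add: by_eq star_diff_right star_assoc algebra_simps)
  qed
  then have "y - b' \<in> lideal f"
    using lideal_diff[OF lideal_star[OF invariant[OF y(1)]] lidealI] by metis
  then have "(y - b') \<star> b - c' \<star> f \<in> lideal f"
    using lideal_diff star_B lidealI b(1) by blast
  moreover have "(y - b') \<star> b - c' \<star> f = y \<star> b - 1"
    by (simp add: star_diff_left bb_eq)
  ultimately show ?thesis using b(1) by metis
qed

end

theorem corollary11: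
  fixes \<sigma> :: "'a::field \<Rightarrow> 'a" and f :: "'a poly" and m :: nat and N :: "'a set"
  assumes "field_automorphism \<sigma>"
    and "lead_coeff f = 1"
    and "degree f = m"
    and "m \<ge> 2"
    and "\<not> right_invariant (skew_poly_ring \<sigma> UNIV) f"
    and "N = nucleus_field \<sigma> f"
    and "f \<in> polys_over (fixed_field \<sigma>)"
    and "bounded_elem (skew_poly_ring \<sigma> UNIV) f"
    and "Nuc_r (petit_algebra \<sigma> UNIV f) = carrier (petit_algebra \<sigma> N f)"
  shows "skew_irreducible (skew_poly_ring \<sigma> UNIV) f \<longleftrightarrow> skew_irreducible (skew_poly_ring \<sigma> N) f"
proof -
  interpret skew_polynomials \<sigma> by unfold_locales (rule assms)
  note monic = \<open>lead_coeff f = 1\<close>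
  have deg: "degree f \<ge> 2" using assms by simp
  then have deg0: "degree f > 0" by simp
  have f0: "f \<noteq> 0" using deg0 by auto
  have N: "stable_subfield N" unfolding \<open>N = _\<close> by (rule stable_subfield_nucleus_field[OF monic deg])
  have fN: "f \<in> polys_over N"
    using fixed_field_subset_nucleus_field[OF monic deg] assms(7) by (auto simp: polys_over_def assms(6))
  have invariant: "f \<star> u \<in> lideal f" if "u \<in> polys_over N" for u
    using star_nucleus_polys[OF monic deg assms(7)] that by (simp add: assms(6))
  have "degree f \<le> degree g \<or> degree f \<le> degree h0"
    if irred: "skew_irreducible (skew_poly_ring \<sigma> N) f" and gh: "f = g \<star> h0" for g h0
  proof (rule ccontr)
    assume "\<not> ?thesis"
    then have less: "degree g < degree f" "degree h0 < degree f" by auto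
    have "degree f = degree g + degree h0" using gh f0 by (simp add: degree_star)
    then have h0: "degree h0 > 0" using less by simp
    have fh0: "f \<in> lideal h0" unfolding gh by (rule lidealI)
    obtain h where h: "f \<in> lideal h" "0 < degree h" "degree h \<le> degree h0"
      and max: "\<And>u. u \<notin> lideal h \<Longrightarrow> \<exists>b c. b \<star> u + c \<star> h = 1"
      using exists_irreducible_right_factor[OF fh0 h0] by blast
    obtain z where z: "z \<noteq> 0" "\<And>r. z \<star> r \<in> lideal f"
      using bounded_elemD[OF assms(8)] by blast
    obtain w where w: "w \<notin> lideal f" "h \<star> w \<in> lideal f"
      using exists_hom_from_simple_quotient[OF h(1,2) max z] by blast
    \<comment> \<open>The homomorphism from \<open>R/Rh\<close> to \<open>R/Rf\<close> that \<open>w\<close> defines is composed with the projection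
      \<open>R/Rf \<rightarrow> R/Rh\<close>; as an endomorphism of \<open>R/Rf\<close> it is represented in the right nucleus.\<close>
    define y where "y = rem f w"
    have wy: "w - y \<in> lideal f" unfolding y_def by (rule right_rem_cong[OF f0])
    then have y: "y \<notin> lideal f" using w(1) lideal_add[of "w - y" f y] by auto
    have "h \<star> w - h \<star> (w - y) \<in> lideal f" by (intro lideal_diff w(2) lideal_star wy)
    then have hy: "h \<star> y \<in> lideal f" by (simp add: star_diff_right)
    have "f \<star> y \<in> lideal f" using h(1) hy by (metis lidealE lideal_star star_assoc)
    then have "y \<in> Nuc_r (petit_algebra \<sigma> UNIV f)"
      using right_rem_degree[OF f0, of w] by (intro Nuc_r_petit_if[OF f0]) (auto simp: y_def)
    then have yN: "y \<in> polys_over N" unfolding assms(9) by (simp add: petit_algebra_def)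
    have inv: "\<exists>b\<in>polys_over N. \<exists>c. b \<star> v + c \<star> f = 1"
      if "v \<in> polys_over N" "v \<notin> lideal f" for v
      using irreducible_left_inverse[OF N fN f0 _ that] irred
      unfolding skew_irreducible_iff[OF deg0] by blast
    obtain b where b: "b \<in> polys_over N" "y \<star> b - 1 \<in> lideal f"
      using right_inverse_of_left_inverses[OF deg0 inv invariant yN y] by blast
    \<comment> \<open>Invertibility of \<open>y\<close> turns \<open>h y = 0\<close> into \<open>h = 0\<close> modulo \<open>R f\<close>.\<close>
    have "h \<star> y \<star> b \<in> lideal f"
      using hy invariant[OF b(1)] by (metis lidealE lideal_star star_assoc)
    moreover have "h \<star> (y \<star> b - 1) \<in> lideal f" by (intro lideal_star b(2))
    ultimately have "h \<star> y \<star> b - h \<star> (y \<star> b - 1) \<in> lideal f" by (rule lideal_diff)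
    then have "h \<in> lideal f" by (simp add: star_diff_right star_assoc)
    then show False using lideal_degree[of h f] h less by force
  qed
  then show ?thesis
    unfolding skew_irreducible_iff[OF deg0] polys_over_UNIV using fN by blast
qed

end
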